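(* Let $\le$ be a binary relation on a set $S$ and let $\Upsilon,\Theta\subseteq S^S$ satisfy $\Theta\circ\Upsilon\subseteq\Theta$. Suppose $(S,\le)$ is $\Theta$-linear. If $\le$ is $(\Upsilon,\Theta)$-correct, then $\le$ is strictly $(\mathrm{id},\Theta)$-linear.
   Context: $S^S$ is the set of all functions $S\to S$; $\Theta\circ\Upsilon=\{\tau\circ\sigma:\tau\in\Theta,\sigma\in\Upsilon\}$; $p<q$ means $p\le q$ and $q\nleq p$. $\le$ is $\Theta$-linear if for all $p,q\in S$ there is $\tau\in\Theta$ with $\tau(p)\le\tau(q)$ or $\tau(q)\le\tau(p)$. $\le$ is $(\Upsilon,\Theta)$-correct if for all $p,q\in S$ with $p\nleq q$ there is $\sigma\in\Upsilon$ such that $\tau(\sigma(p))\nleq\tau(\sigma(q))$ for all $\tau\in\Theta$. $\le$ is strictly $(\mathrm{id},\Theta)$-linear if for all $p,q\in S$, either $p\le q$ or $\tau(q)<\tau(p)$ for some $\tau\in\Theta$. *)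

theory Defs
  imports "HOL-Library.FuncSet"
begin

text \<open>A binary relation on \<open>S\<close> is a predicate of which only the values on \<open>S\<close> matter.
  The set of all functions from \<open>S\<close> to itself is \<^term>\<open>S \<rightarrow>\<^sub>E S\<close>, in which functions are determined by
  their values on \<open>S\<close>; composition is accordingly \<^term>\<open>compose S\<close>.\<close>

definition comp_set :: "'a set \<Rightarrow> ('a \<Rightarrow> 'a) set \<Rightarrow> ('a \<Rightarrow> 'a) set \<Rightarrow> ('a \<Rightarrow> 'a) set" where
  "comp_set S \<Theta> \<Upsilon> = {compose S \<tau> \<sigma> | \<tau> \<sigma>. \<tau> \<in> \<Theta> \<and> \<sigma> \<in> \<Upsilon>}"

definition strict_part :: "('a \<Rightarrow> 'a \<Rightarrow> bool) \<Rightarrow> 'a \<Rightarrow> 'a \<Rightarrow> bool" where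
  "strict_part le p q \<longleftrightarrow> le p q \<and> \<not> le q p"

definition set_linear :: "'a set \<Rightarrow> ('a \<Rightarrow> 'a \<Rightarrow> bool) \<Rightarrow> ('a \<Rightarrow> 'a) set \<Rightarrow> bool" where
  "set_linear S le \<Theta> \<longleftrightarrow>
    (\<forall>p\<in>S. \<forall>q\<in>S. \<exists>\<tau>\<in>\<Theta>. le (\<tau> p) (\<tau> q) \<or> le (\<tau> q) (\<tau> p))"

definition set_correct ::
    "'a set \<Rightarrow> ('a \<Rightarrow> 'a \<Rightarrow> bool) \<Rightarrow> ('a \<Rightarrow> 'a) set \<Rightarrow> ('a \<Rightarrow> 'a) set \<Rightarrow> bool" where
  "set_correct S le \<Upsilon> \<Theta> \<longleftrightarrow>
    (\<forall>p\<in>S. \<forall>q\<in>S. \<not> le p q \<longrightarrow>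
      (\<exists>\<sigma>\<in>\<Upsilon>. \<forall>\<tau>\<in>\<Theta>. \<not> le (\<tau> (\<sigma> p)) (\<tau> (\<sigma> q))))"

text \<open>The disjunction is inclusive: no monotonicity of the functions in \<open>\<Theta>\<close> is assumed, so both
  alternatives may hold.\<close>

definition strictly_id_linear :: "'a set \<Rightarrow> ('a \<Rightarrow> 'a \<Rightarrow> bool) \<Rightarrow> ('a \<Rightarrow> 'a) set \<Rightarrow> bool" where
  "strictly_id_linear S le \<Theta> \<longleftrightarrow>
    (\<forall>p\<in>S. \<forall>q\<in>S. le p q \<or> (\<exists>\<tau>\<in>\<Theta>. strict_part le (\<tau> q) (\<tau> p)))"

end

theory Submission imports Defs begin

text \<open>If \<open>p\<close> is not below \<open>q\<close>, correctness yields one \<sigma> after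
  which no member of \<Theta> can restore \<open>p\<close> below \<open>q\<close>. Linearity,
  applied to the images of \<open>p\<close> and \<open>q\<close> under \<sigma>, yields a \<tau>
  that makes them comparable. The only direction left is the reverse one, and it is strict. Closure
  under composition makes \<tau> after \<sigma> the required witness.\<close>

theorem lemma4p9:
  fixes S :: "'a set"
    and le :: "'a \<Rightarrow> 'a \<Rightarrow> bool"
    and \<Upsilon> \<Theta> :: "('a \<Rightarrow> 'a) set"
  assumes "\<Upsilon> \<subseteq> S \<rightarrow>\<^sub>E S"
    and "\<Theta> \<subseteq> S \<rightarrow>\<^sub>E S"
    and "comp_set S \<Theta> \<Upsilon> \<subseteq> \<Theta>"
    and "set_linear S le \<Theta>"
    and "set_correct S le \<Upsilon> \<Theta>"
  shows "strictly_id_linear S le \<Theta>"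
  unfolding strictly_id_linear_def
proof (intro ballI disj_imp[THEN iffD2] impI)
  fix p q
  assume p: "p \<in> S" and q: "q \<in> S" and "\<not> le p q"
  then obtain \<sigma> where \<sigma>: "\<sigma> \<in> \<Upsilon>"
    and not_le: "\<And>\<tau>. \<tau> \<in> \<Theta> \<Longrightarrow> \<not> le (\<tau> (\<sigma> p)) (\<tau> (\<sigma> q))"
    using assms(5) unfolding set_correct_def by blast
  have "\<sigma> p \<in> S" "\<sigma> q \<in> S"
    using assms(1) \<sigma> p q by auto
  \<comment> \<open>Linearity is used at \<open>\<sigma> p\<close> and \<open>\<sigma> q\<close>,
    not at \<open>p\<close> and \<open>q\<close>; \<open>not_le\<close> rules out one of its two
    disjuncts.\<close>
  then obtain \<tau> where \<tau>: "\<tau> \<in> \<Theta>" and "le (\<tau> (\<sigma> q)) (\<tau> (\<sigma> p))"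
    using assms(4) not_le unfolding set_linear_def by blast
  \<comment> \<open>The same \<open>not_le\<close>, at this \<tau>, now gives strictness.
    \<open>compose S\<close> is the usual composition only on \<open>S\<close>, hence the use of
    \<open>p\<close> and \<open>q\<close>.\<close>
  then have "strict_part le (compose S \<tau> \<sigma> q) (compose S \<tau> \<sigma> p)"
    using not_le p q by (simp add: strict_part_def compose_eq)
  moreover have "compose S \<tau> \<sigma> \<in> \<Theta>"
    using assms(3) \<sigma> \<tau> unfolding comp_set_def by blast
  ultimately show "\<exists>\<tau>\<in>\<Theta>. strict_part le (\<tau> q) (\<tau> p)"
    by blast
qed

end
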